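(* Let $(S,* )$ be a strongly simple multisemigroup which does not contain a zero element and is not isomorphic to the singleton multisemigroup $\mathbf{0}$. The canonical surjective strong homomorphism $\varphi:S\to S/\mathcal{H}$ induces a bijection between the set of maximal (with respect to inclusion) nilpotent submultisemigroups of $S$ and the set of maximal nilpotent sub-quasi-semigroups of $S/\mathcal{H}$. This bijection preserves the nilpotency degree.
   Context: A multisemigroup is a pair $(S,* )$ with $S$ a non-empty set and $*:S\times S\to 2^S$ a map such that $(a*b)*c=a*(b*c)$ for all $a,b,c\in S$, where for $A,B\subset S$ one puts $A*B:=\bigcup_{a\in A,b\in B}a*b$ and an element is identified with the corresponding singleton. An identity is an element $1$ with $1*a=a*1=\{a\}$ for all $a$; $S^1$ denotes $S$ if $S$ has an identity, and otherwise $S\cup\{1\}$ with a new element $1$ acting as the identity. A zero element is $z\in S$ with $a*z=z*a=\{z\}$ for all $a\in S$. $\mathbf{0}=(\{0\},* )$ with $0*0=\varnothing$. A left (right) ideal is a subset $I$ with $s*a\subset I$ (resp. $a*s\subset I$) for all $a\in I,s\in S$; a minimal left (right) ideal is one minimal among the non-empty ones. $a\,\mathcal{L}\,b$ iff $S^1*a=S^1*b$; $a\,\mathcal{R}\,b$ iff $a*S^1=b*S^1$; $\mathcal{H}=\mathcal{L}\cap\mathcal{R}$. $S$ is simple if $S^1*a*S^1=S$ for all $a\in S$; it is strongly simple if it is simple and for every $s\in S$ the set $S^1*s$ is a minimal left ideal and $s*S^1$ is a minimal right ideal. A quasi-semigroup is a multisemigroup in which each product of two elements is either empty or a single element. For strongly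 simple $S$, the relation $\mathcal{H}$ is compatible with $*$ and the quotient set $S/\mathcal{H}$ is a quasi-semigroup with the operation $A\circ B=\{C\in S/\mathcal{H}\mid\exists\, a\in A,b\in B,c\in C: c\in a*b\}$; $\varphi$ sends $s$ to its $\mathcal{H}$-class and is a strong homomorphism, i.e. $\varphi(a)\circ\varphi(b)=\{\varphi(s)\mid s\in a*b\}$. A submultisemigroup (sub-quasi-semigroup) is a non-empty subset $T$ with $a*b\subset T$ for all $a,b\in T$. $T$ is nilpotent if $T^k=\varnothing$ for some $k\in\mathbb{N}$ ($T^k$ being the union of all products of $k$ elements of $T$); the minimal such $k$ is the nilpotency degree of $T$. *)

theory Defs
  imports Main
begin

text \<open>
  Structures are given by a carrier \<open>S\<close> and an operation \<open>m\<close> that is only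
  relevant on \<open>S\<close>.
\<close>

definition set_mult :: "('a \<Rightarrow> 'a \<Rightarrow> 'a set) \<Rightarrow> 'a set \<Rightarrow> 'a set \<Rightarrow> 'a set" where
  "set_mult m A B = (\<Union>a\<in>A. \<Union>b\<in>B. m a b)"

definition multisemigroup :: "'a set \<Rightarrow> ('a \<Rightarrow> 'a \<Rightarrow> 'a set) \<Rightarrow> bool" where
  "multisemigroup S m \<longleftrightarrow>
     S \<noteq> {} \<and>
     (\<forall>a\<in>S. \<forall>b\<in>S. m a b \<subseteq> S) \<and>
     (\<forall>a\<in>S. \<forall>b\<in>S. \<forall>c\<in>S. set_mult m (m a b) {c} = set_mult m {a} (m b c))"

definition is_identity :: "'a set \<Rightarrow> ('a \<Rightarrow> 'a \<Rightarrow> 'a set) \<Rightarrow> 'a \<Rightarrow> bool" where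
  "is_identity S m e \<longleftrightarrow> e \<in> S \<and> (\<forall>a\<in>S. m e a = {a} \<and> m a e = {a})"

definition is_zero :: "'a set \<Rightarrow> ('a \<Rightarrow> 'a \<Rightarrow> 'a set) \<Rightarrow> 'a \<Rightarrow> bool" where
  "is_zero S m z \<longleftrightarrow> z \<in> S \<and> (\<forall>a\<in>S. m a z = {z} \<and> m z a = {z})"

text \<open>
  \<open>S\<^sup>1\<close> lives on the option type: \<open>None\<close> is the new identity, and it is only
  added to the carrier when \<open>S\<close> has no identity of its own.
\<close>

definition carrier1 :: "'a set \<Rightarrow> ('a \<Rightarrow> 'a \<Rightarrow> 'a set) \<Rightarrow> 'a option set" where
  "carrier1 S m =
     (if \<exists>e. is_identity S m e then Some ` S else insert None (Some ` S))"

fun mult1 :: "('a \<Rightarrow> 'a \<Rightarrow> 'a set) \<Rightarrow> 'a option \<Rightarrow> 'a option \<Rightarrow> 'a option set" where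
  "mult1 m None y = {y}"
| "mult1 m x None = {x}"
| "mult1 m (Some a) (Some b) = Some ` m a b"

text \<open>
  The sets \<open>S\<^sup>1 * a\<close>, \<open>a * S\<^sup>1\<close> and \<open>S\<^sup>1 * a * S\<^sup>1\<close>. For \<open>a \<in> S\<close> they never
  contain the adjoined identity, so taking the preimage under \<open>Some\<close> loses
  nothing and merely views them as subsets of \<open>S\<close>.
\<close>

definition left_gen :: "'a set \<Rightarrow> ('a \<Rightarrow> 'a \<Rightarrow> 'a set) \<Rightarrow> 'a \<Rightarrow> 'a set" where
  "left_gen S m a = Some -` set_mult (mult1 m) (carrier1 S m) {Some a}"

definition right_gen :: "'a set \<Rightarrow> ('a \<Rightarrow> 'a \<Rightarrow> 'a set) \<Rightarrow> 'a \<Rightarrow> 'a set" where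
  "right_gen S m a = Some -` set_mult (mult1 m) {Some a} (carrier1 S m)"

definition two_sided_gen :: "'a set \<Rightarrow> ('a \<Rightarrow> 'a \<Rightarrow> 'a set) \<Rightarrow> 'a \<Rightarrow> 'a set" where
  "two_sided_gen S m a =
     Some -` set_mult (mult1 m)
               (set_mult (mult1 m) (carrier1 S m) {Some a}) (carrier1 S m)"

definition left_ideal :: "'a set \<Rightarrow> ('a \<Rightarrow> 'a \<Rightarrow> 'a set) \<Rightarrow> 'a set \<Rightarrow> bool" where
  "left_ideal S m I \<longleftrightarrow> I \<subseteq> S \<and> (\<forall>a\<in>I. \<forall>s\<in>S. m s a \<subseteq> I)"

definition right_ideal :: "'a set \<Rightarrow> ('a \<Rightarrow> 'a \<Rightarrow> 'a set) \<Rightarrow> 'a set \<Rightarrow> bool" where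
  "right_ideal S m I \<longleftrightarrow> I \<subseteq> S \<and> (\<forall>a\<in>I. \<forall>s\<in>S. m a s \<subseteq> I)"

definition minimal_left_ideal :: "'a set \<Rightarrow> ('a \<Rightarrow> 'a \<Rightarrow> 'a set) \<Rightarrow> 'a set \<Rightarrow> bool" where
  "minimal_left_ideal S m I \<longleftrightarrow>
     left_ideal S m I \<and> I \<noteq> {} \<and>
     (\<forall>J. left_ideal S m J \<and> J \<noteq> {} \<and> J \<subseteq> I \<longrightarrow> J = I)"

definition minimal_right_ideal :: "'a set \<Rightarrow> ('a \<Rightarrow> 'a \<Rightarrow> 'a set) \<Rightarrow> 'a set \<Rightarrow> bool" where
  "minimal_right_ideal S m I \<longleftrightarrow>
     right_ideal S m I \<and> I \<noteq> {} \<and>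
     (\<forall>J. right_ideal S m J \<and> J \<noteq> {} \<and> J \<subseteq> I \<longrightarrow> J = I)"

definition simple :: "'a set \<Rightarrow> ('a \<Rightarrow> 'a \<Rightarrow> 'a set) \<Rightarrow> bool" where
  "simple S m \<longleftrightarrow> (\<forall>a\<in>S. two_sided_gen S m a = S)"

definition strongly_simple :: "'a set \<Rightarrow> ('a \<Rightarrow> 'a \<Rightarrow> 'a set) \<Rightarrow> bool" where
  "strongly_simple S m \<longleftrightarrow>
     simple S m \<and>
     (\<forall>s\<in>S. minimal_left_ideal S m (left_gen S m s) \<and>
            minimal_right_ideal S m (right_gen S m s))"

definition L_rel :: "'a set \<Rightarrow> ('a \<Rightarrow> 'a \<Rightarrow> 'a set) \<Rightarrow> 'a rel" where
  "L_rel S m = {(a, b). a \<in> S \<and> b \<in> S \<and> left_gen S m a = left_gen S m b}"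

definition R_rel :: "'a set \<Rightarrow> ('a \<Rightarrow> 'a \<Rightarrow> 'a set) \<Rightarrow> 'a rel" where
  "R_rel S m = {(a, b). a \<in> S \<and> b \<in> S \<and> right_gen S m a = right_gen S m b}"

definition H_rel :: "'a set \<Rightarrow> ('a \<Rightarrow> 'a \<Rightarrow> 'a set) \<Rightarrow> 'a rel" where
  "H_rel S m = L_rel S m \<inter> R_rel S m"

definition H_quot :: "'a set \<Rightarrow> ('a \<Rightarrow> 'a \<Rightarrow> 'a set) \<Rightarrow> 'a set set" where
  "H_quot S m = S // H_rel S m"

definition H_mult ::
    "'a set \<Rightarrow> ('a \<Rightarrow> 'a \<Rightarrow> 'a set) \<Rightarrow> 'a set \<Rightarrow> 'a set \<Rightarrow> 'a set set" where
  "H_mult S m A B = {C \<in> H_quot S m. \<exists>a\<in>A. \<exists>b\<in>B. \<exists>c\<in>C. c \<in> m a b}"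

definition H_proj :: "'a set \<Rightarrow> ('a \<Rightarrow> 'a \<Rightarrow> 'a set) \<Rightarrow> 'a \<Rightarrow> 'a set" where
  "H_proj S m s = H_rel S m `` {s}"

definition isomorphic ::
    "'a set \<Rightarrow> ('a \<Rightarrow> 'a \<Rightarrow> 'a set) \<Rightarrow> 'b set \<Rightarrow> ('b \<Rightarrow> 'b \<Rightarrow> 'b set) \<Rightarrow> bool" where
  "isomorphic S m S' m' \<longleftrightarrow>
     (\<exists>f. bij_betw f S S' \<and> (\<forall>a\<in>S. \<forall>b\<in>S. f ` m a b = m' (f a) (f b)))"

text \<open>The multisemigroup \<open>\<^bold>0\<close>: one element, with empty product.\<close>

definition bold0_carrier :: "nat set" where
  "bold0_carrier = {0}"

definition bold0_mult :: "nat \<Rightarrow> nat \<Rightarrow> nat set" where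
  "bold0_mult a b = {}"

text \<open>
  Being a quasi-semigroup is a property of the ambient structure only, so the
  same predicate describes submultisemigroups and sub-quasi-semigroups.
\<close>

definition submultisemigroup :: "'a set \<Rightarrow> ('a \<Rightarrow> 'a \<Rightarrow> 'a set) \<Rightarrow> 'a set \<Rightarrow> bool" where
  "submultisemigroup S m T \<longleftrightarrow> T \<subseteq> S \<and> T \<noteq> {} \<and> (\<forall>a\<in>T. \<forall>b\<in>T. m a b \<subseteq> T)"

text \<open>
  \<open>set_power m T k\<close> is \<open>T\<^sup>k\<close> for \<open>k \<ge> 1\<close>, bracketed to the left. The value at
  \<open>k = 0\<close> is a dummy; exponents below are always required to be positive.
\<close>

definition set_power :: "('a \<Rightarrow> 'a \<Rightarrow> 'a set) \<Rightarrow> 'a set \<Rightarrow> nat \<Rightarrow> 'a set" where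
  "set_power m T k = ((\<lambda>X. set_mult m X T) ^^ (k - 1)) T"

definition nilpotent :: "('a \<Rightarrow> 'a \<Rightarrow> 'a set) \<Rightarrow> 'a set \<Rightarrow> bool" where
  "nilpotent m T \<longleftrightarrow> (\<exists>k\<ge>1. set_power m T k = {})"

text \<open>Only meaningful for nilpotent \<open>T\<close>.\<close>

definition nilpotency_degree :: "('a \<Rightarrow> 'a \<Rightarrow> 'a set) \<Rightarrow> 'a set \<Rightarrow> nat" where
  "nilpotency_degree m T = (LEAST k. k \<ge> 1 \<and> set_power m T k = {})"

definition maximal_nilpotents :: "'a set \<Rightarrow> ('a \<Rightarrow> 'a \<Rightarrow> 'a set) \<Rightarrow> 'a set set" where
  "maximal_nilpotents S m =
     {T. submultisemigroup S m T \<and> nilpotent m T \<and>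
         (\<forall>T'. submultisemigroup S m T' \<and> nilpotent m T' \<and> T \<subseteq> T' \<longrightarrow> T' = T)}"

end

theory Submission
  imports Defs
begin

text \<open>
  The statement is a formal consequence of \<open>\<phi>\<close> being a surjective strong homomorphism. Such a map
  commutes with the multiplication of subsets, hence with powers: \<open>\<phi>(T)\<^sup>k = \<phi>(T\<^sup>k)\<close>. Since the image
  of a set is empty only if the set is, a subset \<open>T\<close> of \<open>S\<close> and its image vanish at the same powers.
  Images and full preimages of substructures are substructures, so both constructions preserve
  nilpotency. A maximal nilpotent \<open>T\<close> lies in the full preimage of its image, which is nilpotent,
  and therefore equals it. So \<open>T\<close> is saturated, and taking preimages inverts taking images on the
  maximal nilpotent substructures.

  That \<open>\<phi>\<close> is a strong homomorphism rests on two observations. If \<open>c \<in> a * b\<close>, then minimality of the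
  principal one-sided ideals gives \<open>c \<L> b\<close> and \<open>c \<R> a\<close>; so every element of \<open>a * b\<close> lies in the
  single \<open>\<H>\<close>-class determined by the \<open>\<R>\<close>-class of \<open>a\<close> and the \<open>\<L>\<close>-class of \<open>b\<close>. It remains to see
  that whether \<open>a * b\<close> is empty depends only on the classes of the factors: if \<open>a' \<L> a\<close>, then \<open>a'\<close> is
  \<open>a\<close> or lies in some \<open>s * a\<close>, so \<open>a' * b\<close> lies in \<open>a * b\<close> or in \<open>s * (a * b)\<close> and is empty whenever
  \<open>a * b\<close> is; dually for \<open>\<R>\<close> in the right factor.
\<close>

section \<open>Nilpotent substructures under surjective strong homomorphisms\<close>

locale surj_strong_hom =
  fixes S :: "'a set" and m :: "'a \<Rightarrow> 'a \<Rightarrow> 'a set"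
    and Q :: "'b set" and n :: "'b \<Rightarrow> 'b \<Rightarrow> 'b set"
    and f :: "'a \<Rightarrow> 'b"
  assumes closed: "a \<in> S \<Longrightarrow> b \<in> S \<Longrightarrow> m a b \<subseteq> S"
    and surj: "f ` S = Q"
    and hom: "a \<in> S \<Longrightarrow> b \<in> S \<Longrightarrow> n (f a) (f b) = f ` m a b"
begin

abbreviation preim :: "'b set \<Rightarrow> 'a set" where
  "preim U \<equiv> {s \<in> S. f s \<in> U}"

lemma set_mult_closed: "A \<subseteq> S \<Longrightarrow> B \<subseteq> S \<Longrightarrow> set_mult m A B \<subseteq> S"
  unfolding set_mult_def using closed by blast

lemma set_mult_image:
  assumes "A \<subseteq> S" "B \<subseteq> S"
  shows "set_mult n (f ` A) (f ` B) = f ` set_mult m A B"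
proof -
  have "n (f a) (f b) = f ` m a b" if "a \<in> A" "b \<in> B" for a b
    using hom assms that by blast
  then show ?thesis
    unfolding set_mult_def by (simp add: image_UN)
qed

lemma set_power_image:
  assumes "T \<subseteq> S"
  shows "set_power n (f ` T) k = f ` set_power m T k"
proof -
  have "((\<lambda>X. set_mult m X T) ^^ j) T \<subseteq> S \<and>
        ((\<lambda>X. set_mult n X (f ` T)) ^^ j) (f ` T) = f ` ((\<lambda>X. set_mult m X T) ^^ j) T" for j
  proof (induction j)
    case 0
    then show ?case
      using assms by simp
  next
    case (Suc j)
    then show ?case
      using assms by (simp add: set_mult_closed set_mult_image)
  qed
  then show ?thesis
    unfolding set_power_def by blast
qed

lemma nilpotent_image_iff: "T \<subseteq> S \<Longrightarrow> nilpotent n (f ` T) \<longleftrightarrow> nilpotent m T"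
  by (simp add: nilpotent_def set_power_image)

lemma nilpotency_degree_image:
  "T \<subseteq> S \<Longrightarrow> nilpotency_degree n (f ` T) = nilpotency_degree m T"
  by (simp add: nilpotency_degree_def set_power_image)

lemma submultisemigroup_image:
  assumes "submultisemigroup S m T"
  shows "submultisemigroup Q n (f ` T)"
proof -
  have T: "T \<subseteq> S" "T \<noteq> {}" "\<And>a b. a \<in> T \<Longrightarrow> b \<in> T \<Longrightarrow> m a b \<subseteq> T"
    using assms unfolding submultisemigroup_def by auto
  have "n (f a) (f b) \<subseteq> f ` T" if "a \<in> T" "b \<in> T" for a b
    using hom[of a b] T that by blast
  then show ?thesis
    using T(1,2) surj unfolding submultisemigroup_def by blast
qed

lemma image_preim: "U \<subseteq> Q \<Longrightarrow> f ` preim U = U"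
  using surj by blast

lemma submultisemigroup_preim:
  assumes "submultisemigroup Q n U"
  shows "submultisemigroup S m (preim U)"
proof -
  have U: "U \<subseteq> Q" "U \<noteq> {}" "\<And>a b. a \<in> U \<Longrightarrow> b \<in> U \<Longrightarrow> n a b \<subseteq> U"
    using assms unfolding submultisemigroup_def by auto
  have "m a b \<subseteq> preim U" if "a \<in> preim U" "b \<in> preim U" for a b
    using U(3)[of "f a" "f b"] hom[of a b] closed[of a b] that by blast
  moreover have "preim U \<noteq> {}"
    using image_preim[OF U(1)] U(2) by blast
  ultimately show ?thesis
    unfolding submultisemigroup_def by blast
qed

lemma nilpotent_preim_iff: "U \<subseteq> Q \<Longrightarrow> nilpotent m (preim U) \<longleftrightarrow> nilpotent n U"
  using nilpotent_image_iff[of "preim U"] image_preim[of U] by auto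

text \<open>
  A maximal nilpotent substructure is a union of fibres: adjoining to it the rest of the fibres that
  it meets keeps it a nilpotent substructure.
\<close>

lemma preim_image_maximal_nilpotent:
  assumes "T \<in> maximal_nilpotents S m"
  shows "preim (f ` T) = T"
proof -
  have T: "submultisemigroup S m T" "nilpotent m T" "T \<subseteq> S"
    and max: "\<And>T'. submultisemigroup S m T' \<Longrightarrow> nilpotent m T' \<Longrightarrow> T \<subseteq> T' \<Longrightarrow> T' = T"
    using assms unfolding maximal_nilpotents_def submultisemigroup_def by auto
  have img: "submultisemigroup Q n (f ` T)" "nilpotent n (f ` T)"
    using T by (simp_all add: submultisemigroup_image nilpotent_image_iff)
  then have "submultisemigroup S m (preim (f ` T))" "nilpotent m (preim (f ` T))"
    using nilpotent_preim_iff[of "f ` T"]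
    by (auto simp: submultisemigroup_preim submultisemigroup_def[of Q])
  then show ?thesis
    using T(3) by (intro max) auto
qed

lemma image_maximal_nilpotent:
  assumes "T \<in> maximal_nilpotents S m"
  shows "f ` T \<in> maximal_nilpotents Q n"
proof -
  have T: "submultisemigroup S m T" "nilpotent m T" "T \<subseteq> S"
    and max: "\<And>T'. submultisemigroup S m T' \<Longrightarrow> nilpotent m T' \<Longrightarrow> T \<subseteq> T' \<Longrightarrow> T' = T"
    using assms unfolding maximal_nilpotents_def submultisemigroup_def by auto
  have "U = f ` T" if U: "submultisemigroup Q n U" "nilpotent n U" "f ` T \<subseteq> U" for U
  proof -
    have "U \<subseteq> Q"
      using U(1) unfolding submultisemigroup_def by simp
    moreover have "T \<subseteq> preim U"
      using U(3) T(3) by blast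
    ultimately have "preim U = T"
      using U submultisemigroup_preim nilpotent_preim_iff by (intro max) simp_all
    then show ?thesis
      using image_preim[OF \<open>U \<subseteq> Q\<close>] by simp
  qed
  then show ?thesis
    using T submultisemigroup_image nilpotent_image_iff
    unfolding maximal_nilpotents_def by simp
qed

lemma preim_maximal_nilpotent:
  assumes "U \<in> maximal_nilpotents Q n"
  shows "preim U \<in> maximal_nilpotents S m"
proof -
  have U: "submultisemigroup Q n U" "nilpotent n U" "U \<subseteq> Q"
    and max: "\<And>U'. submultisemigroup Q n U' \<Longrightarrow> nilpotent n U' \<Longrightarrow> U \<subseteq> U' \<Longrightarrow> U' = U"
    using assms unfolding maximal_nilpotents_def submultisemigroup_def by auto
  have "T = preim U" if T: "submultisemigroup S m T" "nilpotent m T" "preim U \<subseteq> T" for T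
  proof -
    have "T \<subseteq> S"
      using T(1) unfolding submultisemigroup_def by simp
    moreover have "U \<subseteq> f ` T"
      using image_preim[OF U(3)] T(3) by blast
    ultimately have "f ` T = U"
      using T submultisemigroup_image nilpotent_image_iff by (intro max) simp_all
    then show ?thesis
      using T(3) \<open>T \<subseteq> S\<close> by blast
  qed
  then show ?thesis
    using U submultisemigroup_preim nilpotent_preim_iff
    unfolding maximal_nilpotents_def by simp
qed

theorem bij_betw_maximal_nilpotents:
  "bij_betw (\<lambda>T. f ` T) (maximal_nilpotents S m) (maximal_nilpotents Q n)"
proof (rule bij_betw_byWitness[where f' = preim])
  show "\<forall>T\<in>maximal_nilpotents S m. preim (f ` T) = T"
    using preim_image_maximal_nilpotent by blast
  show "\<forall>U\<in>maximal_nilpotents Q n. f ` preim U = U"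
    using image_preim by (simp add: maximal_nilpotents_def submultisemigroup_def)
  show "(\<lambda>T. f ` T) ` maximal_nilpotents S m \<subseteq> maximal_nilpotents Q n"
    using image_maximal_nilpotent by blast
  show "preim ` maximal_nilpotents Q n \<subseteq> maximal_nilpotents S m"
    using preim_maximal_nilpotent by blast
qed

end

section \<open>The quotient by \<open>\<H>\<close> of a strongly simple multisemigroup\<close>

lemma left_gen_eq:
  assumes "a \<in> S"
  shows "left_gen S m a = insert a (\<Union>s\<in>S. m s a)"
proof (cases "\<exists>e. is_identity S m e")
  case True
  then have "a \<in> (\<Union>s\<in>S. m s a)"
    using assms unfolding is_identity_def by blast
  moreover have "left_gen S m a = (\<Union>s\<in>S. m s a)"
    using True unfolding left_gen_def carrier1_def set_mult_def by auto
  ultimately show ?thesis by blast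
next
  case False
  then show ?thesis
    unfolding left_gen_def carrier1_def set_mult_def by auto
qed

lemma right_gen_eq:
  assumes "a \<in> S"
  shows "right_gen S m a = insert a (\<Union>s\<in>S. m a s)"
proof (cases "\<exists>e. is_identity S m e")
  case True
  then have "a \<in> (\<Union>s\<in>S. m a s)"
    using assms unfolding is_identity_def by blast
  moreover have "right_gen S m a = (\<Union>s\<in>S. m a s)"
    using True unfolding right_gen_def carrier1_def set_mult_def by auto
  ultimately show ?thesis by blast
next
  case False
  then show ?thesis
    unfolding right_gen_def carrier1_def set_mult_def by auto
qed

lemma L_rel_if_mem_left_gen:
  assumes "strongly_simple S m" "b \<in> S" "c \<in> left_gen S m b"
  shows "(c, b) \<in> L_rel S m"
proof -
  have "left_ideal S m (left_gen S m b)"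
    and min: "\<And>J. left_ideal S m J \<Longrightarrow> J \<noteq> {} \<Longrightarrow> J \<subseteq> left_gen S m b \<Longrightarrow> J = left_gen S m b"
    using assms(1,2) unfolding strongly_simple_def minimal_left_ideal_def by blast+
  then have "c \<in> S" "insert c (\<Union>s\<in>S. m s c) \<subseteq> left_gen S m b"
    using assms(3) unfolding left_ideal_def by blast+
  then have c: "c \<in> S" "left_gen S m c \<subseteq> left_gen S m b"
    using left_gen_eq[of c S m] by simp_all
  then have "left_ideal S m (left_gen S m c)" "left_gen S m c \<noteq> {}"
    using assms(1) unfolding strongly_simple_def minimal_left_ideal_def by blast+
  then show ?thesis
    using min c assms(2) unfolding L_rel_def by simp
qed

lemma R_rel_if_mem_right_gen:
  assumes "strongly_simple S m" "a \<in> S" "c \<in> right_gen S m a"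
  shows "(c, a) \<in> R_rel S m"
proof -
  have "right_ideal S m (right_gen S m a)"
    and min: "\<And>J. right_ideal S m J \<Longrightarrow> J \<noteq> {} \<Longrightarrow> J \<subseteq> right_gen S m a \<Longrightarrow> J = right_gen S m a"
    using assms(1,2) unfolding strongly_simple_def minimal_right_ideal_def by blast+
  then have "c \<in> S" "insert c (\<Union>s\<in>S. m c s) \<subseteq> right_gen S m a"
    using assms(3) unfolding right_ideal_def by blast+
  then have c: "c \<in> S" "right_gen S m c \<subseteq> right_gen S m a"
    using right_gen_eq[of c S m] by simp_all
  then have "right_ideal S m (right_gen S m c)" "right_gen S m c \<noteq> {}"
    using assms(1) unfolding strongly_simple_def minimal_right_ideal_def by blast+
  then show ?thesis
    using min c assms(2) unfolding R_rel_def by simp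
qed

lemma equiv_H_rel: "equiv S (H_rel S m)"
  unfolding H_rel_def L_rel_def R_rel_def
  by (rule equivI) (auto simp: refl_on_def sym_def trans_def)

text \<open>
  The product determines both classes of its elements: \<open>\<R>\<close> from the left factor and \<open>\<L>\<close> from the
  right one. Hence products of \<open>\<H>\<close>-related factors all fall into one \<open>\<H>\<close>-class.
\<close>

lemma H_rel_products:
  assumes "strongly_simple S m"
    and "(a, a') \<in> H_rel S m" "(b, b') \<in> H_rel S m"
    and "c \<in> m a b" "c' \<in> m a' b'"
  shows "(c, c') \<in> H_rel S m"
proof -
  have S: "a \<in> S" "b \<in> S" "a' \<in> S" "b' \<in> S"
    using assms(2,3) unfolding H_rel_def L_rel_def by auto
  have "(c, b) \<in> L_rel S m" "(c', b') \<in> L_rel S m"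
    using assms(1,4,5) S by (auto intro!: L_rel_if_mem_left_gen simp: left_gen_eq)
  moreover have "(c, a) \<in> R_rel S m" "(c', a') \<in> R_rel S m"
    using assms(1,4,5) S by (auto intro!: R_rel_if_mem_right_gen simp: right_gen_eq)
  ultimately show ?thesis
    using assms(2,3) unfolding H_rel_def L_rel_def R_rel_def by auto
qed

text \<open>
  Emptiness of \<open>a * b\<close> passes along \<open>\<L>\<close> in the left factor and along \<open>\<R>\<close> in the right one, because
  the relating elements are multiplied on the outside of \<open>a * b\<close>.
\<close>

lemma mult_empty_L_rel:
  assumes "multisemigroup S m" "(a, a') \<in> L_rel S m" "b \<in> S" "m a b = {}"
  shows "m a' b = {}"
proof (cases "a' = a")
  case False
  have S: "a \<in> S" "a' \<in> S" and "a' \<in> left_gen S m a"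
    using assms(2) left_gen_eq[of a' S m] unfolding L_rel_def by auto
  then obtain s where s: "s \<in> S" "a' \<in> m s a"
    using False left_gen_eq[of a S m] by auto
  then have "m a' b \<subseteq> set_mult m (m s a) {b}"
    unfolding set_mult_def by blast
  also have "\<dots> = set_mult m {s} (m a b)"
    using assms(1,3) S s unfolding multisemigroup_def by blast
  also have "\<dots> = {}"
    using assms(4) unfolding set_mult_def by simp
  finally show ?thesis by simp
qed (use assms in simp)

lemma mult_empty_R_rel:
  assumes "multisemigroup S m" "(b, b') \<in> R_rel S m" "a \<in> S" "m a b = {}"
  shows "m a b' = {}"
proof (cases "b' = b")
  case False
  have S: "b \<in> S" "b' \<in> S" and "b' \<in> right_gen S m b"
    using assms(2) right_gen_eq[of b' S m] unfolding R_rel_def by auto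
  then obtain s where s: "s \<in> S" "b' \<in> m b s"
    using False right_gen_eq[of b S m] by auto
  then have "m a b' \<subseteq> set_mult m {a} (m b s)"
    unfolding set_mult_def by blast
  also have "\<dots> = set_mult m (m a b) {s}"
    using assms(1,3) S s unfolding multisemigroup_def by blast
  also have "\<dots> = {}"
    using assms(4) unfolding set_mult_def by simp
  finally show ?thesis by simp
qed (use assms in simp)

lemma mult_empty_H_rel:
  assumes "multisemigroup S m" "(a, a') \<in> H_rel S m" "(b, b') \<in> H_rel S m" "m a b = {}"
  shows "m a' b' = {}"
proof -
  have "(a, a') \<in> L_rel S m" "(b, b') \<in> R_rel S m" "b \<in> S" "a' \<in> S"
    using assms(2,3) unfolding H_rel_def L_rel_def by auto
  then show ?thesis
    using assms(1,4) mult_empty_L_rel mult_empty_R_rel by metis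
qed

lemma H_mult_H_proj:
  assumes ms: "multisemigroup S m" and ss: "strongly_simple S m" and S: "a \<in> S" "b \<in> S"
  shows "H_mult S m (H_proj S m a) (H_proj S m b) = H_proj S m ` m a b"
proof (rule equalityI)
  show "H_proj S m ` m a b \<subseteq> H_mult S m (H_proj S m a) (H_proj S m b)"
  proof (rule image_subsetI)
    fix c assume c: "c \<in> m a b"
    then have "c \<in> S"
      using ms S unfolding multisemigroup_def by blast
    moreover have "x \<in> H_proj S m x" if "x \<in> S" for x
      using that equiv_class_self[OF equiv_H_rel] unfolding H_proj_def by simp
    ultimately show "H_proj S m c \<in> H_mult S m (H_proj S m a) (H_proj S m b)"
      using c S unfolding H_mult_def H_quot_def
      by (auto simp: H_proj_def intro: quotientI)
  qed
  show "H_mult S m (H_proj S m a) (H_proj S m b) \<subseteq> H_proj S m ` m a b"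
  proof
    fix C assume "C \<in> H_mult S m (H_proj S m a) (H_proj S m b)"
    then obtain a' b' c' where C: "C \<in> S // H_rel S m" "c' \<in> C"
      and H: "(a, a') \<in> H_rel S m" "(b, b') \<in> H_rel S m" and c': "c' \<in> m a' b'"
      unfolding H_mult_def H_quot_def H_proj_def by blast
    obtain c where c: "c \<in> m a b"
      using mult_empty_H_rel[OF ms H] c' by blast
    then have "(c, c') \<in> H_rel S m"
      using H_rel_products[OF ss H] c' by blast
    moreover obtain x where "C = H_proj S m x" "(x, c') \<in> H_rel S m"
      using C unfolding H_proj_def by (auto elim: quotientE)
    ultimately have "C = H_proj S m c"
      using equiv_class_eq[OF equiv_H_rel] unfolding H_proj_def by metis
    then show "C \<in> H_proj S m ` m a b"
      using c by blast
  qed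
qed

theorem proposition32:
  fixes S :: "'a set" and m :: "'a \<Rightarrow> 'a \<Rightarrow> 'a set"
  assumes "multisemigroup S m"
    and "strongly_simple S m"
    and "\<not> (\<exists>z. is_zero S m z)"
    and "\<not> isomorphic S m bold0_carrier bold0_mult"
  shows "bij_betw (\<lambda>T. H_proj S m ` T)
           (maximal_nilpotents S m)
           (maximal_nilpotents (H_quot S m) (H_mult S m))
       \<and> (\<forall>T \<in> maximal_nilpotents S m.
             nilpotency_degree (H_mult S m) (H_proj S m ` T) = nilpotency_degree m T)"
proof -
  interpret surj_strong_hom S m "H_quot S m" "H_mult S m" "H_proj S m"
  proof
    show "m a b \<subseteq> S" if "a \<in> S" "b \<in> S" for a b
      using assms(1) that unfolding multisemigroup_def by blast
    show "H_proj S m ` S = H_quot S m"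
      unfolding H_proj_def H_quot_def quotient_def by auto
    show "H_mult S m (H_proj S m a) (H_proj S m b) = H_proj S m ` m a b"
      if "a \<in> S" "b \<in> S" for a b
      using H_mult_H_proj[OF assms(1,2) that] .
  qed
  have "T \<subseteq> S" if "T \<in> maximal_nilpotents S m" for T
    using that unfolding maximal_nilpotents_def submultisemigroup_def by simp
  then show ?thesis
    using bij_betw_maximal_nilpotents nilpotency_degree_image by blast
qed

end
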